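(* Let $S$ be a numerical semigroup with multiplicity $3$ and let $(x_1,x_2)\in\mathbb{N}^2$ be its Kunz-coordinates vector. Then either $S$ is irreducible, or $S$ can be minimally decomposed into $3$-irreducible numerical semigroups as $$ S=\begin{cases} \left\langle 3,\frac{3x_1+1}{2}\right\rangle\cap\left\langle 3,\frac{3x_2+2}{2}\right\rangle & \text{if } x_1 \text{ is odd and } x_2 \text{ is even},\\[4pt] \left\langle 3,\frac{3x_1+1}{2}\right\rangle\cap\left\langle 3,\frac{3x_2+5}{2},3x_2+2\right\rangle & \text{if } x_1,x_2 \text{ are odd},\\[4pt] \left\langle 3,3x_1+1,\frac{3x_1+4}{2}\right\rangle\cap\left\langle 3,\frac{3x_2+2}{2}\right\rangle & \text{if } x_1,x_2 \text{ are even},\\[4pt] \left\langle 3,3x_1+1,\frac{3x_1+4}{2}\right\rangle\cap\left\langle 3,\frac{3x_2+5}{2},3x_2+2\right\rangle & \text{if } x_1 \text{ is even and } x_2 \text{ is odd}. \end{cases} $$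
   Context: $\mathbb{N}$ denotes the set of non-negative integers. A numerical semigroup is a subset $S\subseteq\mathbb{N}$ that is closed under addition, contains $0$ and has finite complement $\mathbb{N}\setminus S$. The multiplicity of $S$ is the smallest positive integer belonging to $S$. $\langle a_1,\dots,a_k\rangle$ denotes the set of all non-negative integer combinations of $a_1,\dots,a_k$. If $S$ has multiplicity $m$, let $w_i$ be the least element of $S$ congruent to $i$ modulo $m$, for $i=1,\dots,m-1$; the Kunz-coordinates vector of $S$ is $x=(x_1,\dots,x_{m-1})\in\mathbb{N}^{m-1}$ with $x_i=(w_i-i)/m$. A numerical semigroup is irreducible if it cannot be expressed as an intersection of two numerical semigroups containing it properly. A numerical semigroup with multiplicity $m$ is $m$-irreducible if it cannot be expressed as an intersection of two numerical semigroups with multiplicity $m$ containing it properly. A decomposition of $S$ into $m$-irreducible numerical semigroups is an expression of $S$ as a finite intersection of $m$-irreducible numerical semigroups; it is minimal if the number of semigroups involved is the smallest possible. *)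

theory Defs
  imports "HOL-Number_Theory.Cong"
begin

definition numerical_semigroup :: "nat set \<Rightarrow> bool" where
  "numerical_semigroup S \<longleftrightarrow>
     0 \<in> S \<and> (\<forall>a\<in>S. \<forall>b\<in>S. a + b \<in> S) \<and> finite (UNIV - S)"

definition ns_multiplicity :: "nat set \<Rightarrow> nat" where
  "ns_multiplicity S = (LEAST n. n \<in> S \<and> 0 < n)"

definition semigroup_gen :: "nat set \<Rightarrow> nat set" where
  "semigroup_gen A = {\<Sum>a\<in>B. c a * a | B c. finite B \<and> B \<subseteq> A}"

definition apery_elem :: "nat set \<Rightarrow> nat \<Rightarrow> nat" where
  "apery_elem S i = (LEAST s. s \<in> S \<and> [s = i] (mod ns_multiplicity S))"

(* For i < ns_multiplicity S the element apery_elem S i is i plus a multiple of the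
   multiplicity, so neither the subtraction nor the division below truncates. *)
definition kunz_vector :: "nat set \<Rightarrow> nat list" where
  "kunz_vector S =
     map (\<lambda>i. (apery_elem S i - i) div ns_multiplicity S) [1..<ns_multiplicity S]"

definition irreducible_ns :: "nat set \<Rightarrow> bool" where
  "irreducible_ns S \<longleftrightarrow> numerical_semigroup S \<and>
     \<not> (\<exists>T U. numerical_semigroup T \<and> numerical_semigroup U \<and>
             S \<subset> T \<and> S \<subset> U \<and> S = T \<inter> U)"

definition m_irreducible_ns :: "nat \<Rightarrow> nat set \<Rightarrow> bool" where
  "m_irreducible_ns m S \<longleftrightarrow> numerical_semigroup S \<and> ns_multiplicity S = m \<and>
     \<not> (\<exists>T U. numerical_semigroup T \<and> ns_multiplicity T = m \<and>
             numerical_semigroup U \<and> ns_multiplicity U = m \<and>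
             S \<subset> T \<and> S \<subset> U \<and> S = T \<inter> U)"

(* The list [S1, ..., Sk] stands for the expression S1 \<inter> ... \<inter> Sk with k terms. It has to be
   nonempty, since the empty intersection would be all of UNIV. *)
definition m_irr_decomposition :: "nat \<Rightarrow> nat set \<Rightarrow> nat set list \<Rightarrow> bool" where
  "m_irr_decomposition m S Ts \<longleftrightarrow>
     Ts \<noteq> [] \<and> (\<forall>T\<in>set Ts. m_irreducible_ns m T) \<and> S = \<Inter> (set Ts)"

definition minimal_m_irr_decomposition :: "nat \<Rightarrow> nat set \<Rightarrow> nat set list \<Rightarrow> bool" where
  "minimal_m_irr_decomposition m S Ts \<longleftrightarrow>
     m_irr_decomposition m S Ts \<and>
     (\<forall>Us. m_irr_decomposition m S Us \<longrightarrow> length Ts \<le> length Us)"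

end

theory Submission
  imports Defs
begin

text \<open>
  A numerical semigroup of multiplicity \<open>3\<close> with Kunz coordinates \<open>(x1, x2)\<close> is determined by two
  thresholds: it contains the multiples of \<open>3\<close>, the numbers \<open>1\<close> modulo \<open>3\<close> from \<open>3 * x1 + 1\<close> on and
  the numbers \<open>2\<close> modulo \<open>3\<close> from \<open>3 * x2 + 2\<close> on (\<open>eq_kunz_set\<close>). Closure under addition means
  exactly that doubling one threshold does not undercut the other, that is \<open>x2 \<le> 2 * x1\<close> and
  \<open>x1 \<le> 2 * x2 + 1\<close>, and intersecting two such sets takes the maximum of the thresholds in each
  residue class.

  Keep one threshold and lower the other as far as closure permits. This gives the semigroups with
  coordinates \<open>(x1, x1 div 2)\<close> and \<open>((x2 + 1) div 2, x2)\<close>, whose intersection is the given one.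
  The four cases of the theorem are these two semigroups written by generators, for the two parities
  of \<open>x1\<close> and of \<open>x2\<close>. Both are symmetric or pseudo-symmetric: every gap \<open>n\<close> either is half of the
  largest gap \<open>F\<close> or is completed to \<open>F\<close> by an element of the semigroup. Hence every proper
  oversemigroup contains \<open>F\<close>, and the semigroup is irreducible (\<open>irreducible_if_gaps_reach\<close>).

  If the given semigroup is not irreducible, it differs from both of them, so it is a proper
  intersection of two semigroups of multiplicity \<open>3\<close>; therefore it is not \<open>3\<close>-irreducible, and one
  component cannot suffice.
\<close>

section \<open>Generated semigroups and Apery elements\<close>

lemma semigroup_gen_0: "0 \<in> semigroup_gen A"
  unfolding semigroup_gen_def by (intro CollectI exI[of _ "{}"]) simp

lemma semigroup_gen_base:
  assumes "a \<in> A"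
  shows "a \<in> semigroup_gen A"
proof -
  have "a = (\<Sum>b\<in>{a}. 1 * b)" by simp
  then show ?thesis unfolding semigroup_gen_def using assms
    by (intro CollectI exI[of _ "{a}"] exI[of _ "\<lambda>_. 1"]) auto
qed

lemma semigroup_gen_add:
  assumes "x \<in> semigroup_gen A" "y \<in> semigroup_gen A"
  shows "x + y \<in> semigroup_gen A"
proof -
  obtain B c where B: "x = (\<Sum>a\<in>B. c a * a)" "finite B" "B \<subseteq> A"
    using assms(1) unfolding semigroup_gen_def by blast
  obtain C d where C: "y = (\<Sum>a\<in>C. d a * a)" "finite C" "C \<subseteq> A"
    using assms(2) unfolding semigroup_gen_def by blast
  let ?c = "\<lambda>a. if a \<in> B then c a else 0" and ?d = "\<lambda>a. if a \<in> C then d a else 0"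
  have "x = (\<Sum>a\<in>B \<union> C. ?c a * a)"
    unfolding B(1) using B(2) C(2) by (intro sum.mono_neutral_cong_left) auto
  moreover have "y = (\<Sum>a\<in>B \<union> C. ?d a * a)"
    unfolding C(1) using B(2) C(2) by (intro sum.mono_neutral_cong_left) auto
  ultimately have "x + y = (\<Sum>a\<in>B \<union> C. (?c a + ?d a) * a)"
    by (simp only: sum.distrib add_mult_distrib)
  then show ?thesis unfolding semigroup_gen_def using B(2,3) C(2,3)
    by (intro CollectI exI[of _ "B \<union> C"] exI[of _ "\<lambda>a. ?c a + ?d a"]) auto
qed

lemma mult_mem_if_add_closed:
  fixes M :: "nat set"
  assumes "0 \<in> M" "\<And>a b. a \<in> M \<Longrightarrow> b \<in> M \<Longrightarrow> a + b \<in> M" "a \<in> M"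
  shows "k * a \<in> M"
  using assms by (induction k) auto

lemma semigroup_gen_least:
  assumes "0 \<in> M" "\<And>a b. a \<in> M \<Longrightarrow> b \<in> M \<Longrightarrow> a + b \<in> M" "A \<subseteq> M"
  shows "semigroup_gen A \<subseteq> M"
proof
  fix x assume "x \<in> semigroup_gen A"
  then obtain B c where B: "x = (\<Sum>a\<in>B. c a * a)" "finite B" "B \<subseteq> A"
    unfolding semigroup_gen_def by blast
  have "(\<Sum>a\<in>B. c a * a) \<in> M" using B(2,3)
  proof (induction B rule: finite_induct)
    case empty
    then show ?case using assms(1) by simp
  next
    case (insert b B)
    then have "c b * b \<in> M" using assms by (intro mult_mem_if_add_closed) auto
    then show ?case using insert assms(2) by simp
  qed
  then show "x \<in> M" using B(1) by simp
qed

lemma numerical_semigroup_unbounded: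
  assumes "numerical_semigroup S"
  obtains N where "\<And>n. N \<le> n \<Longrightarrow> n \<in> S"
proof -
  have "finite (UNIV - S)" using assms unfolding numerical_semigroup_def by blast
  then obtain N where "\<forall>n\<in>UNIV - S. n < N" using finite_nat_set_iff_bounded by blast
  then have "n \<in> S" if "N \<le> n" for n using that by (meson DiffI UNIV_I leD)
  then show thesis by (rule that)
qed

lemma ns_multiplicity_mem_pos:
  assumes "numerical_semigroup S"
  shows "ns_multiplicity S \<in> S" "0 < ns_multiplicity S"
proof -
  obtain N where "\<And>n. N \<le> n \<Longrightarrow> n \<in> S" using numerical_semigroup_unbounded[OF assms] by blast
  then have "Suc N \<in> S \<and> 0 < Suc N" by simp
  from LeastI[where P = "\<lambda>n. n \<in> S \<and> 0 < n", OF this]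
  show "ns_multiplicity S \<in> S" "0 < ns_multiplicity S" unfolding ns_multiplicity_def by auto
qed

lemma ns_multiplicity_le:
  assumes "n \<in> S" "0 < n"
  shows "ns_multiplicity S \<le> n"
  unfolding ns_multiplicity_def using assms by (intro Least_le) auto

lemma apery_elem_mem_cong:
  assumes "numerical_semigroup S"
  shows "apery_elem S i \<in> S" "[apery_elem S i = i] (mod ns_multiplicity S)"
proof -
  obtain N where N: "\<And>n. N \<le> n \<Longrightarrow> n \<in> S" using numerical_semigroup_unbounded[OF assms] by blast
  have "N \<le> ns_multiplicity S * N" using ns_multiplicity_mem_pos(2)[OF assms] by simp
  then have "i + ns_multiplicity S * N \<in> S" by (intro N trans_le_add2)
  moreover have "[i + ns_multiplicity S * N = i] (mod ns_multiplicity S)"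
    by (simp add: cong_def)
  ultimately have "\<exists>s. s \<in> S \<and> [s = i] (mod ns_multiplicity S)" by blast
  from LeastI_ex[OF this]
  show "apery_elem S i \<in> S" "[apery_elem S i = i] (mod ns_multiplicity S)"
    unfolding apery_elem_def by auto
qed

text \<open>The multiplicity \<open>m\<close> lies in the semigroup, so adding multiples of \<open>m\<close> to the least element of
  a residue class reaches everything above it in that class.\<close>

lemma mem_iff_apery_elem_le:
  assumes "numerical_semigroup S"
    and cong: "[n = i] (mod ns_multiplicity S)"
  shows "n \<in> S \<longleftrightarrow> apery_elem S i \<le> n"
proof
  assume "n \<in> S"
  then show "apery_elem S i \<le> n" unfolding apery_elem_def using cong by (intro Least_le) auto
next
  let ?m = "ns_multiplicity S"
  assume le: "apery_elem S i \<le> n"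
  have "[n = apery_elem S i] (mod ?m)"
    using apery_elem_mem_cong(2)[OF assms(1)] cong cong_trans cong_sym by blast
  then obtain q where q: "n = apery_elem S i + q * ?m"
    using le by (metis cong_le_nat add.commute)
  have "q * ?m \<in> S"
    using assms(1) ns_multiplicity_mem_pos(1)[OF assms(1)]
    by (intro mult_mem_if_add_closed) (auto simp: numerical_semigroup_def)
  then show "n \<in> S"
    using q apery_elem_mem_cong(1)[OF assms(1)] assms(1) by (simp add: numerical_semigroup_def)
qed

section \<open>Semigroups of multiplicity 3\<close>

definition kunz_set :: "nat \<Rightarrow> nat \<Rightarrow> nat set" where
  "kunz_set a b = {n. (n mod 3 = 1 \<longrightarrow> 3 * a + 1 \<le> n) \<and> (n mod 3 = 2 \<longrightarrow> 3 * b + 2 \<le> n)}"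

lemma kunz_set_iff:
  "3 * q \<in> kunz_set a b"
  "3 * q + 1 \<in> kunz_set a b \<longleftrightarrow> a \<le> q"
  "3 * q + 2 \<in> kunz_set a b \<longleftrightarrow> b \<le> q"
  unfolding kunz_set_def by (auto, presburger+)

lemma mod_3_cases:
  fixes n :: nat
  obtains q where "n = 3 * q" | q where "n = 3 * q + 1" | q where "n = 3 * q + 2"
proof -
  have "n = 3 * (n div 3) \<or> n = 3 * (n div 3) + 1 \<or> n = 3 * (n div 3) + 2" by linarith
  then show thesis using that by blast
qed

lemma kunz_set_eq_iff: "kunz_set a b = kunz_set c d \<longleftrightarrow> a = c \<and> b = d"
proof
  assume eq: "kunz_set a b = kunz_set c d"
  have "a \<le> q \<longleftrightarrow> c \<le> q" "b \<le> q \<longleftrightarrow> d \<le> q" for q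
    using eq kunz_set_iff(2,3) by blast+
  then show "a = c \<and> b = d" by (meson order_antisym order_refl)
qed auto

lemma kunz_set_Int: "kunz_set a b \<inter> kunz_set c d = kunz_set (max a c) (max b d)"
  unfolding kunz_set_def by (auto simp: max_def)

lemma numerical_semigroup_kunz_set:
  assumes "b \<le> 2 * a" "a \<le> 2 * b + 1"
  shows "numerical_semigroup (kunz_set a b)"
  unfolding numerical_semigroup_def
proof (intro conjI ballI)
  show "0 \<in> kunz_set a b" using kunz_set_iff(1)[of 0] by simp
next
  fix x y assume xy: "x \<in> kunz_set a b" "y \<in> kunz_set a b"
  have sums:
    "3 * q + 3 * r = 3 * (q + r)"
    "3 * q + (3 * r + 1) = 3 * (q + r) + 1" "3 * q + 1 + 3 * r = 3 * (q + r) + 1"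
    "3 * q + (3 * r + 2) = 3 * (q + r) + 2" "3 * q + 2 + 3 * r = 3 * (q + r) + 2"
    "3 * q + 1 + (3 * r + 1) = 3 * (q + r) + 2" "3 * q + 1 + (3 * r + 2) = 3 * (q + r + 1)"
    "3 * q + 2 + (3 * r + 1) = 3 * (q + r + 1)" "3 * q + 2 + (3 * r + 2) = 3 * (q + r + 1) + 1"
    for q r :: nat
    by simp_all
  show "x + y \<in> kunz_set a b"
    using assms xy
    by (cases x rule: mod_3_cases; cases y rule: mod_3_cases; simp only: sums kunz_set_iff; linarith)
next
  have "UNIV - kunz_set a b \<subseteq> {..3 * a + 3 * b + 2}" unfolding kunz_set_def by auto
  then show "finite (UNIV - kunz_set a b)" by (rule finite_subset) simp
qed

lemma ns_multiplicity_kunz_set: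
  assumes "1 \<le> a" "1 \<le> b"
  shows "ns_multiplicity (kunz_set a b) = 3"
  unfolding ns_multiplicity_def
proof (rule Least_equality)
  show "3 \<in> kunz_set a b \<and> (0::nat) < 3" using kunz_set_iff(1)[of 1] by simp
next
  fix n assume "n \<in> kunz_set a b \<and> 0 < n"
  moreover from this have "n = 1 \<or> n = 2 \<or> 3 \<le> n" by linarith
  ultimately show "3 \<le> n" using assms by (auto simp: kunz_set_def)
qed

lemma eq_kunz_set:
  assumes S: "numerical_semigroup S" and m: "ns_multiplicity S = 3"
    and "kunz_vector S = [x1, x2]"
  shows "S = kunz_set x1 x2" "1 \<le> x1" "1 \<le> x2" "x2 \<le> 2 * x1" "x1 \<le> 2 * x2 + 1"
proof -
  have x: "(apery_elem S 1 - 1) div 3 = x1" "(apery_elem S 2 - 2) div 3 = x2"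
    using assms(3) by (simp_all add: kunz_vector_def m upt_rec numeral_2_eq_2)
  have "apery_elem S 1 mod 3 = 1" "apery_elem S 2 mod 3 = 2"
    using apery_elem_mem_cong(2)[OF S, of 1] apery_elem_mem_cong(2)[OF S, of 2] m
    by (simp_all add: cong_def)
  with x have w: "apery_elem S 1 = 3 * x1 + 1" "apery_elem S 2 = 3 * x2 + 2"
    by presburger+
  have mem: "n \<in> S" if "n mod 3 = 0" for n
  proof -
    have "(n div 3) * 3 \<in> S" using S ns_multiplicity_mem_pos(1)[OF S] m
      by (intro mult_mem_if_add_closed) (auto simp: numerical_semigroup_def)
    then show ?thesis using that by (metis mod_0_imp_dvd dvd_div_mult_self)
  qed
  have 1: "n \<in> S \<longleftrightarrow> 3 * x1 + 1 \<le> n" if "n mod 3 = 1" for n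
    using mem_iff_apery_elem_le[OF S, of n 1] m w that by (simp add: cong_def)
  have 2: "n \<in> S \<longleftrightarrow> 3 * x2 + 2 \<le> n" if "n mod 3 = 2" for n
    using mem_iff_apery_elem_le[OF S, of n 2] m w that by (simp add: cong_def)
  have "n \<in> S \<longleftrightarrow> n \<in> kunz_set x1 x2" for n
  proof -
    consider "n mod 3 = 0" | "n mod 3 = 1" | "n mod 3 = 2" by linarith
    then show ?thesis using mem[of n] 1[of n] 2[of n] by cases (auto simp: kunz_set_def)
  qed
  then show eq: "S = kunz_set x1 x2" by blast
  have low: "n \<notin> S" if "0 < n" "n < 3" for n using ns_multiplicity_le[of n S] m that by auto
  show "1 \<le> x1" using low[of 1] 1[of 1] by auto
  show "1 \<le> x2" using low[of 2] 2[of 2] by auto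
  have add: "a + b \<in> S" if "a \<in> S" "b \<in> S" for a b
    using S that unfolding numerical_semigroup_def by blast
  have "(3 * x1 + 1) + (3 * x1 + 1) \<in> S" by (rule add; simp only: eq kunz_set_iff order_refl)
  then have "3 * (2 * x1) + 2 \<in> kunz_set x1 x2" using eq by (simp add: algebra_simps)
  then show "x2 \<le> 2 * x1" by (simp only: kunz_set_iff)
  have "(3 * x2 + 2) + (3 * x2 + 2) \<in> S" by (rule add; simp only: eq kunz_set_iff order_refl)
  moreover have "(3 * x2 + 2) + (3 * x2 + 2) = 3 * (2 * x2 + 1) + 1" by simp
  ultimately have "3 * (2 * x2 + 1) + 1 \<in> kunz_set x1 x2" using eq by (simp only:)
  then show "x1 \<le> 2 * x2 + 1" by (simp only: kunz_set_iff)
qed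

text \<open>The two Apery elements together with \<open>3\<close> generate the semigroup, so it suffices that the
  given generators lie in the semigroup and produce these three numbers.\<close>

lemma semigroup_gen_eq_kunz_set:
  assumes "b \<le> 2 * a" "a \<le> 2 * b + 1"
    and A: "3 \<in> A" "A \<subseteq> kunz_set a b"
    and w1: "3 * a + 1 \<in> semigroup_gen A" and w2: "3 * b + 2 \<in> semigroup_gen A"
  shows "semigroup_gen A = kunz_set a b"
proof
  show "semigroup_gen A \<subseteq> kunz_set a b"
    using numerical_semigroup_kunz_set[OF assms(1,2)] A(2)
    by (intro semigroup_gen_least) (auto simp: numerical_semigroup_def)
next
  have three: "q * 3 \<in> semigroup_gen A" for q
    using mult_mem_if_add_closed[OF semigroup_gen_0 semigroup_gen_add semigroup_gen_base[OF A(1)]] .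
  show "kunz_set a b \<subseteq> semigroup_gen A"
  proof
    fix n assume n: "n \<in> kunz_set a b"
    show "n \<in> semigroup_gen A"
    proof (cases n rule: mod_3_cases)
      case (1 q)
      then show ?thesis using three[of q] by (simp add: mult.commute)
    next
      case (2 q)
      then have "n = (3 * a + 1) + (q - a) * 3" using n kunz_set_iff(2) by auto
      then show ?thesis using semigroup_gen_add[OF w1 three] by simp
    next
      case (3 q)
      then have "n = (3 * b + 2) + (q - b) * 3" using n kunz_set_iff(3) by auto
      then show ?thesis using semigroup_gen_add[OF w2 three] by simp
    qed
  qed
qed

lemma semigroup_gen_first_odd:
  assumes "odd x"
  shows "semigroup_gen {3, (3 * x + 1) div 2} = kunz_set x (x div 2)"
proof -
  obtain k where x: "x = 2 * k + 1" using assms oddE by blast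
  then have g: "(3 * x + 1) div 2 = 3 * k + 2" by simp
  have gen: "3 * k + 2 \<in> semigroup_gen {3, 3 * k + 2}" by (intro semigroup_gen_base) simp
  have "semigroup_gen {3, 3 * k + 2} = kunz_set (2 * k + 1) k"
  proof (rule semigroup_gen_eq_kunz_set)
    show "{3, 3 * k + 2} \<subseteq> kunz_set (2 * k + 1) k"
      using kunz_set_iff(1)[of 1] kunz_set_iff(3) by simp
    have "3 * (2 * k + 1) + 1 = (3 * k + 2) + (3 * k + 2)" by simp
    then show "3 * (2 * k + 1) + 1 \<in> semigroup_gen {3, 3 * k + 2}"
      using semigroup_gen_add[OF gen gen] by (simp only:)
  qed (use gen in auto)
  then show ?thesis using g x by simp
qed

lemma semigroup_gen_first_even:
  assumes "even x"
  shows "semigroup_gen {3, 3 * x + 1, (3 * x + 4) div 2} = kunz_set x (x div 2)"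
proof -
  obtain k where x: "x = 2 * k" using assms by blast
  then have g: "(3 * x + 4) div 2 = 3 * k + 2" by simp
  have "semigroup_gen {3, 3 * x + 1, 3 * k + 2} = kunz_set x k"
  proof (rule semigroup_gen_eq_kunz_set)
    show "{3, 3 * x + 1, 3 * k + 2} \<subseteq> kunz_set x k"
      using kunz_set_iff(1)[of 1] kunz_set_iff(2)[of x] kunz_set_iff(3)[of k] by simp
  qed (auto intro: semigroup_gen_base simp: x)
  then show ?thesis using g x by simp
qed

lemma semigroup_gen_second_even:
  assumes "even x"
  shows "semigroup_gen {3, (3 * x + 2) div 2} = kunz_set ((x + 1) div 2) x"
proof -
  obtain k where x: "x = 2 * k" using assms by blast
  then have g: "(3 * x + 2) div 2 = 3 * k + 1" by simp
  have gen: "3 * k + 1 \<in> semigroup_gen {3, 3 * k + 1}" by (intro semigroup_gen_base) simp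
  have "semigroup_gen {3, 3 * k + 1} = kunz_set k (2 * k)"
  proof (rule semigroup_gen_eq_kunz_set)
    show "{3, 3 * k + 1} \<subseteq> kunz_set k (2 * k)"
      using kunz_set_iff(1)[of 1] kunz_set_iff(2)[of k] by simp
    have "3 * (2 * k) + 2 = (3 * k + 1) + (3 * k + 1)" by simp
    then show "3 * (2 * k) + 2 \<in> semigroup_gen {3, 3 * k + 1}"
      using semigroup_gen_add[OF gen gen] by (simp only:)
  qed (use gen in auto)
  then show ?thesis using g x by simp
qed

lemma semigroup_gen_second_odd:
  assumes "odd x"
  shows "semigroup_gen {3, (3 * x + 5) div 2, 3 * x + 2} = kunz_set ((x + 1) div 2) x"
proof -
  obtain k where x: "x = 2 * k + 1" using assms oddE by blast
  then have g: "(3 * x + 5) div 2 = 3 * (k + 1) + 1" by simp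
  have "semigroup_gen {3, 3 * (k + 1) + 1, 3 * x + 2} = kunz_set (k + 1) x"
  proof (rule semigroup_gen_eq_kunz_set)
    show "{3, 3 * (k + 1) + 1, 3 * x + 2} \<subseteq> kunz_set (k + 1) x"
      using kunz_set_iff(1)[of 1] kunz_set_iff(2)[of "k + 1"] kunz_set_iff(3)[of x] by simp
  qed (auto intro: semigroup_gen_base simp: x)
  moreover have "(x + 1) div 2 = k + 1" using x by simp
  ultimately show ?thesis by (simp only: g)
qed

section \<open>Irreducibility\<close>

text \<open>Every semigroup that contains \<open>S\<close> and a gap \<open>n\<close> of \<open>S\<close> also contains \<open>F\<close>: it is the sum of \<open>n\<close>
  with itself or with an element of \<open>S\<close>. Hence \<open>F\<close> lies in any intersection of proper oversemigroups.
  The case \<open>n = F\<close> is the second alternative with \<open>s = 0\<close>.\<close>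

lemma irreducible_if_gaps_reach:
  assumes S: "numerical_semigroup S" and F: "F \<notin> S"
    and gaps: "\<And>n. n \<notin> S \<Longrightarrow> n + n = F \<or> (\<exists>s\<in>S. n + s = F)"
  shows "irreducible_ns S"
proof -
  have "F \<in> T" if T: "numerical_semigroup T" and sub: "S \<subset> T" for T
  proof -
    obtain n where "n \<in> T" "n \<notin> S" using sub by blast
    then show ?thesis using gaps[of n] T sub unfolding numerical_semigroup_def by blast
  qed
  then show ?thesis using S F unfolding irreducible_ns_def by blast
qed

lemma m_irreducible_if_irreducible:
  assumes "irreducible_ns S" "ns_multiplicity S = m"
  shows "m_irreducible_ns m S"
  using assms unfolding irreducible_ns_def m_irreducible_ns_def by blast

text \<open>The largest gap is \<open>F = 3 * x - 2\<close>, and \<open>n \<mapsto> F - n\<close> sends gaps that are \<open>1\<close> modulo \<open>3\<close> to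
  multiples of \<open>3\<close>. It sends a gap \<open>3 * q + 2\<close> to a number of the same residue class with quotient
  \<open>x - 2 - q\<close>. As \<open>q < x div 2\<close>, that number reaches the threshold \<open>x div 2\<close>, except for \<open>2 * q + 2 = x\<close>,
  where \<open>F\<close> is twice the gap.\<close>

lemma irreducible_kunz_set_first:
  assumes "1 \<le> x"
  shows "irreducible_ns (kunz_set x (x div 2))"
proof (rule irreducible_if_gaps_reach)
  show "numerical_semigroup (kunz_set x (x div 2))"
    by (rule numerical_semigroup_kunz_set) linarith+
  let ?F = "3 * (x - 1) + 1"
  show "?F \<notin> kunz_set x (x div 2)" using assms by (simp only: kunz_set_iff)
  fix n assume n: "n \<notin> kunz_set x (x div 2)"
  show "n + n = ?F \<or> (\<exists>s\<in>kunz_set x (x div 2). n + s = ?F)"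
  proof (cases n rule: mod_3_cases)
    case (1 q)
    then show ?thesis using n kunz_set_iff(1) by blast
  next
    case (2 q)
    then have "n + 3 * (x - 1 - q) = ?F" using n kunz_set_iff(2) by auto
    then show ?thesis using kunz_set_iff(1) by blast
  next
    case (3 q)
    then have q: "q < x div 2" using n kunz_set_iff(3) by (meson not_le)
    show ?thesis
    proof (cases "2 * q + 2 = x")
      case True
      then show ?thesis using 3 by auto
    next
      case False
      then have "n + (3 * (x - 2 - q) + 2) = ?F" "x div 2 \<le> x - 2 - q"
        using 3 q by linarith+
      then show ?thesis using kunz_set_iff(3) by blast
    qed
  qed
qed

text \<open>The same reflection with the residue classes \<open>1\<close> and \<open>2\<close> exchanged; now \<open>F = 3 * x - 1\<close>, and
  the exceptional gap is \<open>3 * q + 1\<close> with \<open>2 * q + 1 = x\<close>.\<close>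

lemma irreducible_kunz_set_second:
  assumes "1 \<le> x"
  shows "irreducible_ns (kunz_set ((x + 1) div 2) x)"
proof (rule irreducible_if_gaps_reach)
  show "numerical_semigroup (kunz_set ((x + 1) div 2) x)"
    by (rule numerical_semigroup_kunz_set) linarith+
  let ?F = "3 * (x - 1) + 2"
  show "?F \<notin> kunz_set ((x + 1) div 2) x" using assms by (simp only: kunz_set_iff)
  fix n assume n: "n \<notin> kunz_set ((x + 1) div 2) x"
  show "n + n = ?F \<or> (\<exists>s\<in>kunz_set ((x + 1) div 2) x. n + s = ?F)"
  proof (cases n rule: mod_3_cases)
    case (1 q)
    then show ?thesis using n kunz_set_iff(1) by blast
  next
    case (2 q)
    then have q: "q < (x + 1) div 2" using n kunz_set_iff(2) by (meson not_le)
    show ?thesis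
    proof (cases "2 * q + 1 = x")
      case True
      then show ?thesis using 2 by auto
    next
      case False
      then have "n + (3 * (x - 1 - q) + 1) = ?F" "(x + 1) div 2 \<le> x - 1 - q"
        using 2 q by linarith+
      then show ?thesis using kunz_set_iff(2) by blast
    qed
  next
    case (3 q)
    then have "n + 3 * (x - 1 - q) = ?F" using n kunz_set_iff(3) by auto
    then show ?thesis using kunz_set_iff(1) by blast
  qed
qed

section \<open>The minimal decomposition\<close>

text \<open>A single component would be \<open>S\<close> itself, but \<open>S\<close> is a proper intersection of semigroups of
  multiplicity \<open>m\<close>.\<close>

lemma minimal_decomposition_pair:
  assumes "m_irreducible_ns m T" "m_irreducible_ns m U" "S = T \<inter> U" "S \<noteq> T" "S \<noteq> U"
  shows "minimal_m_irr_decomposition m S [T, U]"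
proof -
  have notirr: "\<not> m_irreducible_ns m S" using assms unfolding m_irreducible_ns_def by blast
  have "2 \<le> length Us" if Us: "m_irr_decomposition m S Us" for Us
  proof (rule ccontr)
    assume "\<not> 2 \<le> length Us"
    moreover have "Us \<noteq> []" using Us unfolding m_irr_decomposition_def by blast
    ultimately obtain V where "Us = [V]" by (cases Us; cases "tl Us") auto
    then show False using Us notirr unfolding m_irr_decomposition_def by auto
  qed
  moreover have "m_irr_decomposition m S [T, U]"
    using assms(1-3) unfolding m_irr_decomposition_def by simp
  ultimately show ?thesis
    unfolding minimal_m_irr_decomposition_def by (simp add: numeral_2_eq_2)
qed

lemma minimal_decomposition_kunz_set:
  assumes "1 \<le> x1" "1 \<le> x2" "x2 \<le> 2 * x1" "x1 \<le> 2 * x2 + 1"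
    and notirr: "\<not> irreducible_ns (kunz_set x1 x2)"
  shows "minimal_m_irr_decomposition 3 (kunz_set x1 x2)
           [kunz_set x1 (x1 div 2), kunz_set ((x2 + 1) div 2) x2]"
proof -
  have ne1: "x2 \<noteq> x1 div 2" using notirr irreducible_kunz_set_first assms(1) by blast
  have ne2: "x1 \<noteq> (x2 + 1) div 2" using notirr irreducible_kunz_set_second assms(2) by blast
  \<comment> \<open>For \<open>x1 = 1\<close> the first component would contain \<open>2\<close> and have a smaller multiplicity; but
    then \<open>x2 \<le> 2\<close>, and the semigroup is irreducible.\<close>
  have "x1 \<noteq> 1" using ne2 assms(2,3) by auto
  then have "1 \<le> x1 div 2" using assms(1) by linarith
  then have "m_irreducible_ns 3 (kunz_set x1 (x1 div 2))"
    using assms(1)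
    by (intro m_irreducible_if_irreducible irreducible_kunz_set_first ns_multiplicity_kunz_set)
  moreover have "m_irreducible_ns 3 (kunz_set ((x2 + 1) div 2) x2)"
    using assms(2)
    by (intro m_irreducible_if_irreducible irreducible_kunz_set_second ns_multiplicity_kunz_set)
      linarith+
  moreover have "kunz_set x1 x2 = kunz_set x1 (x1 div 2) \<inter> kunz_set ((x2 + 1) div 2) x2"
  proof -
    have "max x1 ((x2 + 1) div 2) = x1" "max (x1 div 2) x2 = x2" using assms(3,4) by linarith+
    then show ?thesis by (simp only: kunz_set_Int)
  qed
  ultimately show ?thesis
    using ne1 ne2 by (intro minimal_decomposition_pair) (auto simp: kunz_set_eq_iff)
qed

theorem corollary15:
  fixes S :: "nat set" and x1 x2 :: nat
  assumes "numerical_semigroup S"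
    and "ns_multiplicity S = 3"
    and "kunz_vector S = [x1, x2]"
  shows "irreducible_ns S \<or>
    ((odd x1 \<and> even x2 \<longrightarrow> minimal_m_irr_decomposition 3 S
        [semigroup_gen {3, (3 * x1 + 1) div 2},
         semigroup_gen {3, (3 * x2 + 2) div 2}]) \<and>
     (odd x1 \<and> odd x2 \<longrightarrow> minimal_m_irr_decomposition 3 S
        [semigroup_gen {3, (3 * x1 + 1) div 2},
         semigroup_gen {3, (3 * x2 + 5) div 2, 3 * x2 + 2}]) \<and>
     (even x1 \<and> even x2 \<longrightarrow> minimal_m_irr_decomposition 3 S
        [semigroup_gen {3, 3 * x1 + 1, (3 * x1 + 4) div 2},
         semigroup_gen {3, (3 * x2 + 2) div 2}]) \<and>
     (even x1 \<and> odd x2 \<longrightarrow> minimal_m_irr_decomposition 3 S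
        [semigroup_gen {3, 3 * x1 + 1, (3 * x1 + 4) div 2},
         semigroup_gen {3, (3 * x2 + 5) div 2, 3 * x2 + 2}]))"
proof (cases "irreducible_ns S")
  case False
  note kunz = eq_kunz_set[OF assms]
  have "minimal_m_irr_decomposition 3 S [kunz_set x1 (x1 div 2), kunz_set ((x2 + 1) div 2) x2]"
    using minimal_decomposition_kunz_set[OF kunz(2-5)] kunz(1) False by simp
  then show ?thesis
    by (intro disjI2 conjI impI; elim conjE)
      (simp_all only: semigroup_gen_first_odd semigroup_gen_first_even semigroup_gen_second_odd
        semigroup_gen_second_even not_False_eq_True)
qed simp

end
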